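(* Let $k\in\mathbb N$, let $\theta>0$, and let $\mu=(\mu_1,\dots,\mu_k)$ and $\nu=(\nu_1,\dots,\nu_k)$ be any compositions with $k$ parts (vectors of non-negative integers). Then $$\mathbb{E}\left(\prod_{j=1}^{k}c_{\mu_j}\overline{c_{\nu_j}}\right)=\sum_{A\in\mathrm{Mag}_{\mu,\nu}}\ \prod_{1\le i,j\le k}\binom{A_{ij}+\theta-1}{A_{ij}} .$$
   Context: Let $(\mathcal N_k)_{k\ge1}$ be i.i.d. standard complex normal random variables ($\mathbb{E}\mathcal N_k=0$, $\mathbb{E}\mathcal N_k^2=0$, $\mathbb{E}|\mathcal N_k|^2=1$). For $\theta>0$ and $n\ge0$, $c_n$ is the coefficient of $z^n$ in the power series expansion of $\exp\left(\sqrt\theta\sum_{k=1}^\infty\frac{z^k}{\sqrt k}\mathcal N_k\right)$ at $z=0$. $\mathrm{Mag}_{\mu,\nu}$ is the set of $k\times k$ matrices $A$ with entries in $\mathbb N_0=\{0,1,2,\dots\}$ such that $\sum_{j=1}^kA_{ij}=\mu_i$ for $i=1,\dots,k$ and $\sum_{i=1}^kA_{ij}=\nu_j$ for $j=1,\dots,k$ (magic squares). For a non-negative integer $a$, $\binom{a+\theta-1}{a}=\frac{\Gamma(a+\theta)}{\Gamma(\theta)\,a!}$. *)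

theory Defs
  imports
    "HOL-Probability.Probability"
    "HOL-Complex_Analysis.Complex_Analysis"
    "HOL-Computational_Algebra.Computational_Algebra"
begin

(* The variances 1/2 of the independent real and imaginary parts amount to
   E Z = 0, E Z^2 = 0, E |Z|^2 = 1.  Note that normal_density takes the
   standard deviation, not the variance. *)
definition std_complex_normal :: "'a measure \<Rightarrow> ('a \<Rightarrow> complex) \<Rightarrow> bool" where
  "std_complex_normal M Z \<longleftrightarrow>
     distributed M lborel (\<lambda>\<omega>. Re (Z \<omega>)) (\<lambda>x. ennreal (normal_density 0 (sqrt (1/2)) x)) \<and>
     distributed M lborel (\<lambda>\<omega>. Im (Z \<omega>)) (\<lambda>x. ennreal (normal_density 0 (sqrt (1/2)) x)) \<and>
     prob_space.indep_var M borel (\<lambda>\<omega>. Re (Z \<omega>)) borel (\<lambda>\<omega>. Im (Z \<omega>))"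

definition log_series :: "real \<Rightarrow> (nat \<Rightarrow> complex) \<Rightarrow> complex fps" where
  "log_series \<theta> w =
     Abs_fps (\<lambda>k. if k = 0 then 0 else of_real (sqrt \<theta>) * (w k / of_real (sqrt (real k))))"

(* The coefficient is taken in the formal power series ring, so that it is
   defined for every outcome, including the null set on which the series in
   the exponent may have radius of convergence 0.  Whenever that radius is
   positive, it is the Taylor coefficient at 0 of the actual function, see
   has_fps_expansion_exp_log_series below. *)
definition secular_coeff :: "real \<Rightarrow> (nat \<Rightarrow> 'a \<Rightarrow> complex) \<Rightarrow> nat \<Rightarrow> 'a \<Rightarrow> complex" where
  "secular_coeff \<theta> N n \<omega> = fps_nth (fps_exp 1 oo log_series \<theta> (\<lambda>k. N k \<omega>)) n"

lemma has_fps_expansion_exp_log_series: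
  assumes "fps_conv_radius (log_series \<theta> w) > 0"
  shows "(\<lambda>z. exp (eval_fps (log_series \<theta> w) z)) has_fps_expansion (fps_exp 1 oo log_series \<theta> w)"
proof -
  have "(exp \<circ> eval_fps (log_series \<theta> w)) has_fps_expansion (fps_exp 1 oo log_series \<theta> w)"
    by (rule has_fps_expansion_compose[OF has_fps_expansion_exp1 eval_fps_has_fps_expansion[OF assms]])
       (simp add: log_series_def)
  thus ?thesis by (simp add: o_def)
qed

definition Mag :: "nat ^ 'k \<Rightarrow> nat ^ 'k \<Rightarrow> (nat ^ 'k ^ 'k) set" where
  "Mag \<mu> \<nu> = {A. (\<forall>i. (\<Sum>j\<in>UNIV. A $ i $ j) = \<mu> $ i) \<and> (\<forall>j. (\<Sum>i\<in>UNIV. A $ i $ j) = \<nu> $ j)}"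

lemma finite_Mag: "finite (Mag \<mu> (\<nu> :: nat ^ 'k))"
proof -
  let ?F = "{f :: 'k \<Rightarrow> nat. f \<in> (\<Pi>\<^sub>E i\<in>UNIV. {..(\<Sum>i\<in>UNIV. \<mu> $ i)})}"
  let ?G = "{f :: 'k \<Rightarrow> nat ^ 'k. f \<in> (\<Pi>\<^sub>E i\<in>UNIV. vec_lambda ` ?F)}"
  have "finite ?F" by (auto intro!: finite_PiE)
  hence "finite ?G" by (auto intro!: finite_PiE)
  moreover have "Mag \<mu> \<nu> \<subseteq> vec_lambda ` ?G"
  proof
    fix A assume A: "A \<in> Mag \<mu> \<nu>"
    have bound: "A $ i $ j \<le> (\<Sum>i\<in>UNIV. \<mu> $ i)" for i j
    proof -
      have "A $ i $ j \<le> (\<Sum>j\<in>UNIV. A $ i $ j)" by (rule member_le_sum) auto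
      also have "\<dots> = \<mu> $ i" using A by (simp add: Mag_def)
      also have "\<dots> \<le> (\<Sum>i\<in>UNIV. \<mu> $ i)" by (rule member_le_sum) auto
      finally show ?thesis .
    qed
    have "A $ i \<in> vec_lambda ` ?F" for i
      by (rule image_eqI[where x = "vec_nth (A $ i)"]) (use bound in auto)
    thus "A \<in> vec_lambda ` ?G"
      by (intro image_eqI[where x = "vec_nth A"]) auto
  qed
  ultimately show ?thesis by (meson finite_imageI finite_subset)
qed

lemma gbinomial_eq_Gamma:
  fixes \<theta> :: real
  assumes "\<theta> > 0"
  shows "(real a + \<theta> - 1) gchoose a = Gamma (real a + \<theta>) / (Gamma \<theta> * fact a)"
proof -
  have "real a + \<theta> - 1 + 1 \<notin> \<int>\<^sub>\<le>\<^sub>0"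
    using assms by (auto elim!: nonpos_Ints_cases)
  from gbinomial_Gamma[OF this] show ?thesis by (simp add: mult.commute)
qed

end

theory Submission
  imports Defs
begin

text \<open>
  Differentiating the generating function gives
  \<open>n c\<^sub>n = sqrt \<theta> * (\<Sum>k=1..n. sqrt k * N\<^sub>k * c\<^bsub>n-k\<^esub>)\<close>, and the derivative of
  \<open>cnj c\<^sub>n\<close> with respect to \<open>cnj N\<^sub>k\<close> is \<open>sqrt (\<theta> / k) * cnj c\<^bsub>n-k\<^esub>\<close>. Gaussian integration by
  parts, which says that the expectation of \<open>N\<^sub>k F\<close> is that of the derivative of \<open>F\<close> with
  respect to \<open>cnj N\<^sub>k\<close>, therefore expresses \<open>\<mu>\<^sub>i\<close> times the expectation as \<open>\<theta>\<close> times the sum, over all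
  \<open>j\<close> and \<open>1 \<le> k \<le> min \<mu>\<^sub>i \<nu>\<^sub>j\<close>, of the expectations with \<open>\<mu>\<^sub>i\<close> and \<open>\<nu>\<^sub>j\<close> both lowered by \<open>k\<close>.
  The sum over magic squares satisfies the same recursion, because the weights
  \<open>g a = (a + \<theta> - 1) gchoose a\<close> satisfy \<open>a * g a = \<theta> * (\<Sum>k=1..a. g (a - k))\<close>.
\<close>

no_notation fps_nth (infixl "$" 75) \<comment> \<open>clashes with \<open>vec_nth\<close>\<close>

section \<open>Gaussian moments\<close>

text \<open>The moments of the normal distribution with mean 0 and variance 1/2.\<close>

definition half_normal_moment :: "nat \<Rightarrow> real" where
  "half_normal_moment n = (if even n then fact n / (4 ^ (n div 2) * fact (n div 2)) else 0)"

text \<open>This is one-variable integration by parts at variance \<open>1/2\<close>,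
  \<open>E X^(n+1) = (n/2) E X^(n-1)\<close>. At \<open>n = 0\<close> the truncated
  \<open>n - 1\<close> is harmless because of the factor \<open>n\<close>.\<close>

lemma half_normal_moment_Suc:
  "half_normal_moment (Suc n) = real n / 2 * half_normal_moment (n - 1)"
proof (cases n)
  case (Suc m)
  show ?thesis
  proof (cases "even m")
    case True
    then obtain l where l: "m = 2 * l" by (elim evenE)
    have "fact (Suc (Suc (2 * l))) = 2 * (1 + real l) * (1 + 2 * real l) * fact (2 * l)"
      by (simp add: algebra_simps)
    then have "half_normal_moment (Suc (Suc (2 * l))) =
        2 * (1 + real l) * (1 + 2 * real l) * fact (2 * l) / (4 * 4 ^ l * ((1 + real l) * fact l))"
      by (simp add: half_normal_moment_def)
    also have "\<dots> = (1 + 2 * real l) / 2 * (fact (2 * l) / (4 ^ l * fact l))"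
      by (simp add: divide_simps)
    finally show ?thesis
      by (simp add: Suc l half_normal_moment_def)
  qed (simp add: Suc half_normal_moment_def)
qed (simp add: half_normal_moment_def)

lemma (in prob_space) half_normal_moment:
  assumes "distributed M lborel X (\<lambda>x. ennreal (normal_density 0 (sqrt (1/2)) x))"
  shows "has_bochner_integral M (\<lambda>\<omega>. X \<omega> ^ n) (half_normal_moment n)"
proof -
  have m: "has_bochner_integral lborel (\<lambda>x. normal_density 0 (sqrt (1/2)) x * x ^ n) (half_normal_moment n)"
  proof (cases "even n")
    case True
    then obtain k where k: "n = 2 * k" by (elim evenE)
    show ?thesis
      \<comment> \<open>The even central moments of a normal variable contain the base
        \<open>2 / \<sigma>^2\<close>, which is \<open>4\<close> at variance
        \<open>1/2\<close>.\<close>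
      using normal_moment_even[of "sqrt (1/2)" 0 k]
      by (simp add: k half_normal_moment_def)
  next
    case False
    then obtain k where k: "n = 2 * k + 1" by (elim oddE)
    show ?thesis
      using normal_moment_odd[of "sqrt (1/2)" 0 k]
      by (simp add: k half_normal_moment_def)
  qed
  have "integrable M (\<lambda>\<omega>. X \<omega> ^ n)"
    using m distributed_integrable[OF assms, of "\<lambda>x. x ^ n"]
    by (simp add: has_bochner_integral_iff)
  moreover have "(\<integral>\<omega>. X \<omega> ^ n \<partial>M) = half_normal_moment n"
    using m distributed_integral[OF assms, of "\<lambda>x. x ^ n"]
    by (simp add: has_bochner_integral_iff)
  ultimately show ?thesis
    by (simp add: has_bochner_integral_iff)
qed

lemma (in prob_space) std_complex_normal_moment:
  assumes "std_complex_normal M Z"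
  shows "has_bochner_integral M (\<lambda>\<omega>. Re (Z \<omega>) ^ a * Im (Z \<omega>) ^ b)
           (half_normal_moment a * half_normal_moment b)"
proof -
  note re = half_normal_moment[of "\<lambda>\<omega>. Re (Z \<omega>)" a]
    and im = half_normal_moment[of "\<lambda>\<omega>. Im (Z \<omega>)" b]
  from assms have ind: "indep_var borel (\<lambda>\<omega>. Re (Z \<omega>)) borel (\<lambda>\<omega>. Im (Z \<omega>))"
    by (simp add: std_complex_normal_def)
  have ind': "indep_var borel (\<lambda>\<omega>. Re (Z \<omega>) ^ a) borel (\<lambda>\<omega>. Im (Z \<omega>) ^ b)"
    using indep_var_compose[OF ind, of "\<lambda>x. x ^ a" borel "\<lambda>x. x ^ b" borel]
    by (simp add: o_def)
  show ?thesis
    using re im assms indep_var_integrable[OF ind'] indep_var_lebesgue_integral[OF ind']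
    by (simp add: std_complex_normal_def has_bochner_integral_iff)
qed

section \<open>Wirtinger derivatives of polynomials in the Gaussian variables\<close>

text \<open>Real and imaginary parts serve as the variables, instead of \<open>z i\<close> and
  \<open>cnj (z i)\<close>, because they are independent with known moments.\<close>

definition monomial :: "nat set \<Rightarrow> (nat \<Rightarrow> complex) \<Rightarrow> (nat \<Rightarrow> nat) \<Rightarrow> (nat \<Rightarrow> nat) \<Rightarrow> complex" where
  "monomial I z a b = (\<Prod>i\<in>I. of_real (Re (z i) ^ a i * Im (z i) ^ b i))"

lemma monomial_remove:
  assumes "finite I" "k \<in> I"
  shows "monomial I z a b = of_real (Re (z k)) ^ a k * of_real (Im (z k)) ^ b k * monomial (I - {k}) z a b"
  unfolding monomial_def by (subst prod.remove[OF assms]) simp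

lemma monomial_remove_upd [simp]:
  "monomial (I - {k}) z (a(k := u)) b = monomial (I - {k}) z a b"
  "monomial (I - {k}) z a (b(k := u)) = monomial (I - {k}) z a b"
  by (auto simp: monomial_def intro!: prod.cong)

lemma monomial_mult:
  "monomial I z a b * monomial I z a' b' = monomial I z (\<lambda>i. a i + a' i) (\<lambda>i. b i + b' i)"
  by (simp add: monomial_def power_add mult_ac flip: prod.distrib)

text \<open>Formal value of
  \<open>(\<partial>/\<partial>x + \<i> \<partial>/\<partial>y) / 2\<close> on a monomial, with
  \<open>x\<close> and \<open>y\<close> the parts of \<open>z k\<close>. A zero exponent truncates
  in \<open>a k - 1\<close>, but its coefficient then vanishes.\<close>

definition dbar_monomial :: "nat set \<Rightarrow> nat \<Rightarrow> (nat \<Rightarrow> complex) \<Rightarrow> (nat \<Rightarrow> nat) \<Rightarrow> (nat \<Rightarrow> nat) \<Rightarrow> complex" where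
  "dbar_monomial I k z a b =
     (of_nat (a k) * monomial I z (a(k := a k - 1)) b + \<i> * of_nat (b k) * monomial I z a (b(k := b k - 1))) / 2"

text \<open>The product rule for \<open>x^m * x^n\<close> as an algebraic identity; zero exponents
  need separate cases because of the truncated subtraction.\<close>

lemma power_deriv_mult:
  fixes x :: complex
  shows "of_nat (m + n) * x ^ (m + n - 1) = of_nat m * x ^ (m - 1) * x ^ n + x ^ m * (of_nat n * x ^ (n - 1))"
  by (cases m; cases n) (simp_all add: algebra_simps power_add)

text \<open>Leibniz rule: only the powers of the real and imaginary parts of \<open>z k\<close> are
  differentiated, and the remaining factors pull out as constants.\<close>

lemma dbar_monomial_mult:
  assumes "finite I" "k \<in> I"
  shows "dbar_monomial I k z (\<lambda>i. a i + a' i) (\<lambda>i. b i + b' i) =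
           dbar_monomial I k z a b * monomial I z a' b' + monomial I z a b * dbar_monomial I k z a' b'"
proof -
  let ?x = "of_real (Re (z k)) :: complex" and ?y = "of_real (Im (z k)) :: complex"
  let ?R = "monomial (I - {k}) z a b" and ?R' = "monomial (I - {k}) z a' b'"
  have d: "dbar_monomial I k z a b = (of_nat (a k) * ?x ^ (a k - 1) * ?y ^ b k +
      \<i> * (?x ^ a k * (of_nat (b k) * ?y ^ (b k - 1)))) / 2 * monomial (I - {k}) z a b" for a b
    unfolding dbar_monomial_def
    by (subst (1 2) monomial_remove[OF assms]) (simp add: algebra_simps add_divide_distrib)
  have R: "monomial (I - {k}) z (\<lambda>i. a i + a' i) (\<lambda>i. b i + b' i) = ?R * ?R'"
    by (simp add: monomial_mult)
  show ?thesis
    unfolding d R power_deriv_mult monomial_remove[OF assms, of z a b] monomial_remove[OF assms, of z a' b']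
    by (simp add: field_simps power_add)
qed

text \<open>
  \<open>has_dbar I k N F F'\<close> says that \<open>F\<close> is a polynomial in the real and imaginary parts of the \<open>N i\<close> with
  \<open>i \<in> I\<close>, and that \<open>F'\<close> is its Wirtinger derivative \<open>(\<partial>/\<partial>x + \<i> \<partial>/\<partial>y) / 2\<close> with respect to \<open>cnj (N k)\<close>.
  It is a relation between random variables rather than an operator on polynomials, so no
  uniqueness of the representation is needed.
\<close>

inductive has_dbar :: "nat set \<Rightarrow> nat \<Rightarrow> (nat \<Rightarrow> 'a \<Rightarrow> complex) \<Rightarrow> ('a \<Rightarrow> complex) \<Rightarrow> ('a \<Rightarrow> complex) \<Rightarrow> bool"
  for I k N where
  monomial: "has_dbar I k N (\<lambda>\<omega>. monomial I (\<lambda>i. N i \<omega>) a b) (\<lambda>\<omega>. dbar_monomial I k (\<lambda>i. N i \<omega>) a b)"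
| add: "has_dbar I k N F F' \<Longrightarrow> has_dbar I k N G G' \<Longrightarrow>
    has_dbar I k N (\<lambda>\<omega>. F \<omega> + G \<omega>) (\<lambda>\<omega>. F' \<omega> + G' \<omega>)"
| scale: "has_dbar I k N F F' \<Longrightarrow> has_dbar I k N (\<lambda>\<omega>. c * F \<omega>) (\<lambda>\<omega>. c * F' \<omega>)"

text \<open>Both sides are bilinear in the two pairs, so a nested induction reduces the Leibniz rule
  to monomials.\<close>

lemma has_dbar_mult:
  assumes I: "finite I" "k \<in> I" and F: "has_dbar I k N F F'" and G: "has_dbar I k N G G'"
  shows "has_dbar I k N (\<lambda>\<omega>. F \<omega> * G \<omega>) (\<lambda>\<omega>. F' \<omega> * G \<omega> + F \<omega> * G' \<omega>)"
  using F
proof induction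
  case (monomial a b)
  show ?case using G
  proof induction
    case (monomial a' b')
    show ?case
      using has_dbar.monomial[of I k N "\<lambda>i. a i + a' i" "\<lambda>i. b i + b' i"]
      by (simp add: monomial_mult dbar_monomial_mult[OF I])
  next
    case (add G1 G1' G2 G2')
    from has_dbar.add[OF add.IH] show ?case by (simp add: algebra_simps)
  next
    case (scale G G' c)
    from has_dbar.scale[OF scale.IH, of c] show ?case by (simp add: algebra_simps)
  qed
next
  case (add F1 F1' F2 F2')
  from has_dbar.add[OF add.IH] show ?case by (simp add: algebra_simps)
next
  case (scale F F' c)
  from has_dbar.scale[OF scale.IH, of c] show ?case by (simp add: algebra_simps)
qed

lemma has_dbar_const: "has_dbar I k N (\<lambda>\<omega>. c) (\<lambda>\<omega>. 0)"
  using has_dbar.scale[OF has_dbar.monomial[of I k N "\<lambda>_. 0" "\<lambda>_. 0"], of c]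
  by (simp add: monomial_def dbar_monomial_def)

lemma has_dbar_sum:
  assumes "\<And>j. j \<in> S \<Longrightarrow> has_dbar I k N (F j) (F' j)"
  shows "has_dbar I k N (\<lambda>\<omega>. \<Sum>j\<in>S. F j \<omega>) (\<lambda>\<omega>. \<Sum>j\<in>S. F' j \<omega>)"
  using assms
  by (induction S rule: infinite_finite_induct) (auto intro: has_dbar_const has_dbar.add)

lemma has_dbar_prod:
  assumes I: "finite I" "k \<in> I" and "finite S" "\<And>j. j \<in> S \<Longrightarrow> has_dbar I k N (F j) (F' j)"
  shows "has_dbar I k N (\<lambda>\<omega>. \<Prod>j\<in>S. F j \<omega>) (\<lambda>\<omega>. \<Sum>j\<in>S. F' j \<omega> * (\<Prod>i\<in>S - {j}. F i \<omega>))"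
  using assms(3,4)
proof (induction S)
  case empty
  then show ?case by (simp add: has_dbar_const)
next
  case (insert x S)
  have *: "F' x \<omega> * (\<Prod>i\<in>S. F i \<omega>) + F x \<omega> * (\<Sum>j\<in>S. F' j \<omega> * (\<Prod>i\<in>S - {j}. F i \<omega>)) =
      (\<Sum>j\<in>insert x S. F' j \<omega> * (\<Prod>i\<in>insert x S - {j}. F i \<omega>))" for \<omega>
  proof -
    have "(\<Prod>i\<in>insert x S - {j}. F i \<omega>) = F x \<omega> * (\<Prod>i\<in>S - {j}. F i \<omega>)" if "j \<in> S" for j
    proof -
      have "insert x S - {j} = insert x (S - {j})" using that insert.hyps by auto
      then show ?thesis using insert.hyps by simp
    qed
    moreover have "insert x S - {x} = S" using insert.hyps by auto
    ultimately show ?thesis using insert.hyps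
      by (simp add: sum_distrib_left mult_ac)
  qed
  have "has_dbar I k N (\<lambda>\<omega>. F x \<omega> * (\<Prod>i\<in>S. F i \<omega>))
      (\<lambda>\<omega>. F' x \<omega> * (\<Prod>i\<in>S. F i \<omega>) + F x \<omega> * (\<Sum>j\<in>S. F' j \<omega> * (\<Prod>i\<in>S - {j}. F i \<omega>)))"
    by (intro has_dbar_mult I insert) auto
  then show ?case unfolding * using insert.hyps by simp
qed

lemma has_dbar_Re:
  assumes "finite I" "i \<in> I"
  shows "has_dbar I k N (\<lambda>\<omega>. of_real (Re (N i \<omega>))) (\<lambda>\<omega>. if i = k then 1 / 2 else 0)"
proof -
  have "monomial I z ((\<lambda>_. 0)(i := 1)) (\<lambda>_. 0) = of_real (Re (z i))" for z
    by (subst monomial_remove[OF assms]) (simp add: monomial_def)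
  moreover have "dbar_monomial I k z ((\<lambda>_. 0)(i := 1)) (\<lambda>_. 0) = (if i = k then 1 / 2 else 0)" for z
    by (auto simp: dbar_monomial_def monomial_def intro!: prod.neutral)
  ultimately show ?thesis
    using has_dbar.monomial[of I k N "(\<lambda>_. 0)(i := 1)" "\<lambda>_. 0"] by simp
qed

lemma has_dbar_Im:
  assumes "finite I" "i \<in> I"
  shows "has_dbar I k N (\<lambda>\<omega>. of_real (Im (N i \<omega>))) (\<lambda>\<omega>. if i = k then \<i> / 2 else 0)"
proof -
  have "monomial I z (\<lambda>_. 0) ((\<lambda>_. 0)(i := 1)) = of_real (Im (z i))" for z
    by (subst monomial_remove[OF assms]) (simp add: monomial_def)
  moreover have "dbar_monomial I k z (\<lambda>_. 0) ((\<lambda>_. 0)(i := 1)) = (if i = k then \<i> / 2 else 0)" for z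
    by (auto simp: dbar_monomial_def monomial_def intro!: prod.neutral)
  ultimately show ?thesis
    using has_dbar.monomial[of I k N "\<lambda>_. 0" "(\<lambda>_. 0)(i := 1)"] by simp
qed

text \<open>The Cauchy-Riemann equation for the identity:
  \<open>1/2 + \<i> * (\<i>/2) = 0\<close>.\<close>

lemma has_dbar_var:
  assumes "finite I" "i \<in> I"
  shows "has_dbar I k N (N i) (\<lambda>\<omega>. 0)"
proof -
  have "has_dbar I k N (\<lambda>\<omega>. of_real (Re (N i \<omega>)) + \<i> * of_real (Im (N i \<omega>)))
      (\<lambda>\<omega>. (if i = k then 1 / 2 else 0) + \<i> * (if i = k then \<i> / 2 else 0))"
    by (intro has_dbar.add has_dbar.scale has_dbar_Re has_dbar_Im assms)
  moreover have "(if i = k then 1 / 2 else 0) + \<i> * (if i = k then \<i> / 2 else 0) = 0"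
    by simp
  ultimately show ?thesis by (simp only: flip: complex_eq)
qed

text \<open>Conjugation flips the sign of the second term, and
  \<open>1/2 - \<i> * (\<i>/2) = 1\<close>.\<close>

lemma has_dbar_cnj_var:
  assumes "finite I" "i \<in> I"
  shows "has_dbar I k N (\<lambda>\<omega>. cnj (N i \<omega>)) (\<lambda>\<omega>. if i = k then 1 else 0)"
proof -
  have "has_dbar I k N (\<lambda>\<omega>. of_real (Re (N i \<omega>)) + (- \<i>) * of_real (Im (N i \<omega>)))
      (\<lambda>\<omega>. (if i = k then 1 / 2 else 0) + (- \<i>) * (if i = k then \<i> / 2 else 0))"
    by (intro has_dbar.add has_dbar.scale has_dbar_Re has_dbar_Im assms)
  moreover have "(if i = k then 1 / 2 else 0) + (- \<i>) * (if i = k then \<i> / 2 else 0) = (if i = k then 1 else 0)"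
    by simp
  moreover have "of_real (Re w) + (- \<i>) * of_real (Im w) = cnj w" for w
    by (simp add: complex_eq_iff)
  ultimately show ?thesis by (simp only:)
qed

section \<open>Recursion and derivatives of the coefficients\<close>

lemma secular_coeff_0 [simp]: "secular_coeff \<theta> N 0 \<omega> = 1"
  by (simp add: secular_coeff_def)

text \<open>Compares coefficients of \<open>z^(n-1)\<close> in \<open>C' = C * L'\<close>, where
  \<open>C\<close> is the exponential of the log series \<open>L\<close>.\<close>

lemma secular_coeff_rec:
  "of_nat n * secular_coeff \<theta> N n \<omega> =
     of_real (sqrt \<theta>) * (\<Sum>k=1..n. of_real (sqrt k) * N k \<omega> * secular_coeff \<theta> N (n - k) \<omega>)"
proof (cases n)
  case (Suc m)
  let ?L = "log_series \<theta> (\<lambda>k. N k \<omega>)"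
  let ?C = "fps_exp 1 oo ?L"
  have "fps_deriv ?C = ?C * fps_deriv ?L"
    by (subst fps_compose_deriv) (simp_all add: log_series_def)
  then have "fps_nth (fps_deriv ?C) m = (\<Sum>i=0..m. fps_nth ?C i * fps_nth (fps_deriv ?L) (m - i))"
    by (simp add: fps_mult_nth)
  also have "\<dots> = (\<Sum>k=1..n. fps_nth ?C (n - k) * fps_nth (fps_deriv ?L) (k - 1))"
    by (rule sum.reindex_bij_witness[of _ "\<lambda>k. n - k" "\<lambda>i. n - i"]) (auto simp: Suc)
  also have "\<dots> = (\<Sum>k=1..n. of_real (sqrt \<theta>) * (of_real (sqrt k) * N k \<omega> * fps_nth ?C (n - k)))"
  proof (rule sum.cong)
    fix k assume "k \<in> {1..n}"
    then obtain l where l: "k = Suc l" by (cases k) auto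
    \<comment> \<open>Differentiation brings down a factor \<open>k\<close>, which turns the weight
      \<open>1 / sqrt k\<close> into \<open>sqrt k\<close>.\<close>
    have "of_nat k / of_real (sqrt (real k)) = (of_real (sqrt (real k)) :: complex)"
      by (metis of_real_divide of_real_of_nat_eq real_div_sqrt of_nat_0_le_iff)
    moreover have "fps_nth (fps_deriv ?L) (k - 1) = of_real (sqrt \<theta>) * (of_nat k / of_real (sqrt k)) * N k \<omega>"
      by (simp add: log_series_def l)
    ultimately show "fps_nth ?C (n - k) * fps_nth (fps_deriv ?L) (k - 1) =
        of_real (sqrt \<theta>) * (of_real (sqrt k) * N k \<omega> * fps_nth ?C (n - k))"
      by simp
  qed simp
  finally show ?thesis
    by (simp add: secular_coeff_def Suc distrib_left sum_distrib_left)
qed simp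

text \<open>By the recursion, the coefficient is a polynomial in \<open>N 1, ..., N n\<close>
  without conjugates. The condition on \<open>I\<close> makes all these variables available.\<close>

lemma has_dbar_secular_coeff:
  assumes "finite I" "{1..n} \<subseteq> I" "k \<in> I"
  shows "has_dbar I k N (secular_coeff \<theta> N n) (\<lambda>\<omega>. 0)"
  using assms(2)
proof (induction n rule: less_induct)
  case (less n)
  show ?case
  proof (cases "n = 0")
    case False
    have "has_dbar I k N (\<lambda>\<omega>. of_real (sqrt \<theta>) / of_nat n *
        (\<Sum>j=1..n. of_real (sqrt j) * (N j \<omega> * secular_coeff \<theta> N (n - j) \<omega>)))
      (\<lambda>\<omega>. of_real (sqrt \<theta>) / of_nat n *
        (\<Sum>j=1..n. of_real (sqrt j) * (0 * secular_coeff \<theta> N (n - j) \<omega> + N j \<omega> * 0)))"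
      using less.prems
      by (intro has_dbar.scale has_dbar_sum has_dbar_mult assms has_dbar_var less.IH) (auto intro!: subsetD[OF less.prems])
    moreover have "secular_coeff \<theta> N n \<omega> = of_real (sqrt \<theta>) / of_nat n *
        (\<Sum>j=1..n. of_real (sqrt j) * (N j \<omega> * secular_coeff \<theta> N (n - j) \<omega>))" for \<omega>
      using False secular_coeff_rec[of n \<theta> N \<omega>] by (simp add: field_simps)
    then have "secular_coeff \<theta> N n = (\<lambda>\<omega>. of_real (sqrt \<theta>) / of_nat n *
        (\<Sum>j=1..n. of_real (sqrt j) * (N j \<omega> * secular_coeff \<theta> N (n - j) \<omega>)))" by blast
    ultimately show ?thesis by simp
  next
    case True
    have "secular_coeff \<theta> N 0 = (\<lambda>\<omega>. 1)" by auto
    with True show ?thesis using has_dbar_const[of I k N 1] by simp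
  qed
qed

lemma cnj_secular_coeff_rec:
  "of_nat n * cnj (secular_coeff \<theta> N n \<omega>) =
     of_real (sqrt \<theta>) * (\<Sum>k=1..n. of_real (sqrt k) * (cnj (N k \<omega>) * cnj (secular_coeff \<theta> N (n - k) \<omega>)))"
  using arg_cong[OF secular_coeff_rec[of n \<theta> N \<omega>], of cnj] by (simp add: mult.assoc)

text \<open>Differentiating the exponential multiplies it by
  \<open>sqrt (\<theta> / k) * z^k\<close>, which shifts coefficients by \<open>k\<close>. The proof
  obtains this by strong induction along the conjugated recursion.\<close>

lemma has_dbar_cnj_secular_coeff:
  assumes "finite I" "{1..n} \<subseteq> I" "k \<in> I" "k \<ge> 1"
  shows "has_dbar I k N (\<lambda>\<omega>. cnj (secular_coeff \<theta> N n \<omega>))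
           (\<lambda>\<omega>. if k \<le> n then of_real (sqrt (\<theta> / k)) * cnj (secular_coeff \<theta> N (n - k) \<omega>) else 0)"
  using assms(2)
proof (induction n rule: less_induct)
  case (less n)
  let ?c = "\<lambda>n \<omega>. cnj (secular_coeff \<theta> N n \<omega>)"
  let ?D = "\<lambda>n \<omega>. if k \<le> n then of_real (sqrt (\<theta> / k)) * ?c (n - k) \<omega> else 0"
  show ?case
  proof (cases "n = 0")
    case False
    have "has_dbar I k N (\<lambda>\<omega>. of_real (sqrt \<theta>) / of_nat n *
        (\<Sum>j=1..n. of_real (sqrt j) * (cnj (N j \<omega>) * ?c (n - j) \<omega>)))
      (\<lambda>\<omega>. of_real (sqrt \<theta>) / of_nat n *
        (\<Sum>j=1..n. of_real (sqrt j) * ((if j = k then 1 else 0) * ?c (n - j) \<omega> + cnj (N j \<omega>) * ?D (n - j) \<omega>)))"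
      using less.prems
      by (intro has_dbar.scale has_dbar_sum has_dbar_mult assms has_dbar_cnj_var less.IH) (auto intro!: subsetD[OF less.prems])
    moreover have "?c n = (\<lambda>\<omega>. of_real (sqrt \<theta>) / of_nat n *
        (\<Sum>j=1..n. of_real (sqrt j) * (cnj (N j \<omega>) * ?c (n - j) \<omega>)))"
      using False cnj_secular_coeff_rec[of n \<theta> N] by (simp add: fun_eq_iff field_simps)
    moreover have "of_real (sqrt \<theta>) / of_nat n *
        (\<Sum>j=1..n. of_real (sqrt j) * ((if j = k then 1 else 0) * ?c (n - j) \<omega> + cnj (N j \<omega>) * ?D (n - j) \<omega>)) =
        ?D n \<omega>" for \<omega>
    proof (cases "k \<le> n")
      case True
      \<comment> \<open>Terms with \<open>j > n - k\<close> have zero derivative; the others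
        reassemble into the recursion for \<open>n - k\<close> and contribute weight
        \<open>n - k\<close>.\<close>
      have "(\<Sum>j=1..n. of_real (sqrt j) * (cnj (N j \<omega>) * ?D (n - j) \<omega>)) =
        (\<Sum>j=1..n-k. of_real (sqrt j) * (cnj (N j \<omega>) * (of_real (sqrt (\<theta> / k)) * ?c (n - k - j) \<omega>)))"
        using True by (intro sum.mono_neutral_cong_right) (auto simp: algebra_simps)
      also have "\<dots> = of_real (sqrt (\<theta> / k)) *
          (\<Sum>j=1..n-k. of_real (sqrt j) * (cnj (N j \<omega>) * ?c (n - k - j) \<omega>))"
        by (simp add: sum_distrib_left mult_ac)
      finally have *: "of_real (sqrt \<theta>) * (\<Sum>j=1..n. of_real (sqrt j) * (cnj (N j \<omega>) * ?D (n - j) \<omega>)) =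
          of_real (sqrt (\<theta> / k)) * (of_nat (n - k) * ?c (n - k) \<omega>)"
        unfolding cnj_secular_coeff_rec by simp
      \<comment> \<open>The explicit variable is differentiated only at \<open>j = k\<close>. This
        contributes weight \<open>k\<close>, so the total weight \<open>n\<close> cancels the
        division by \<open>n\<close>.\<close>
      have "(\<Sum>j=1..n. of_real (sqrt j) * ((if j = k then 1 else 0) * ?c (n - j) \<omega>)) =
          (\<Sum>j=1..n. if j = k then of_real (sqrt k) * ?c (n - k) \<omega> else 0)"
        by (intro sum.cong) auto
      also have "\<dots> = of_real (sqrt k) * ?c (n - k) \<omega>"
        using True assms(4) by simp
      also have "of_real (sqrt \<theta>) * \<dots> = of_real (sqrt (\<theta> / k)) * (of_nat k * ?c (n - k) \<omega>)"
      proof -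
        have "sqrt \<theta> * sqrt k = sqrt (\<theta> / k) * k"
          using assms(4) by (simp add: real_sqrt_divide field_simps)
        then have "complex_of_real (sqrt \<theta>) * of_real (sqrt k) = of_real (sqrt (\<theta> / k)) * of_nat k"
          by (metis of_real_mult of_real_of_nat_eq)
        then show ?thesis by (simp add: mult.assoc[symmetric])
      qed
      finally have "of_real (sqrt \<theta>) * (\<Sum>j=1..n. of_real (sqrt j) *
          ((if j = k then 1 else 0) * ?c (n - j) \<omega> + cnj (N j \<omega>) * ?D (n - j) \<omega>)) =
          of_real (sqrt (\<theta> / k)) * (of_nat n * ?c (n - k) \<omega>)"
        using * True by (simp only: distrib_left sum.distrib) (simp add: algebra_simps of_nat_diff)
      with True False show ?thesis
        by (simp add: field_simps)
    next
      case False
      then show ?thesis by (auto intro!: sum.neutral)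
    qed
    ultimately show ?thesis by simp
  next
    case True
    then show ?thesis using has_dbar_const[of I k N 1] assms(4) by simp
  qed
qed

section \<open>Products of coefficients\<close>

definition lower :: "nat ^ 'k \<Rightarrow> 'k \<Rightarrow> nat \<Rightarrow> nat ^ 'k" where
  "lower v i k = (\<chi> j. if j = i then v $ i - k else v $ j)"

lemma lower_nth [simp]: "lower v i k $ j = (if j = i then v $ i - k else v $ j)"
  by (simp add: lower_def)

definition secular_prod ::
  "real \<Rightarrow> (nat \<Rightarrow> 'a \<Rightarrow> complex) \<Rightarrow> nat ^ 'k \<Rightarrow> nat ^ 'k \<Rightarrow> 'a \<Rightarrow> complex" where
  "secular_prod \<theta> N \<mu> \<nu> =
     (\<lambda>\<omega>. \<Prod>j\<in>UNIV. secular_coeff \<theta> N (\<mu> $ j) \<omega> * cnj (secular_coeff \<theta> N (\<nu> $ j) \<omega>))"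

text \<open>Exchanges the two margins, which settles the case where \<open>\<mu>\<close> is zero and
  \<open>\<nu>\<close> is not.\<close>

lemma cnj_secular_prod: "cnj (secular_prod \<theta> N \<mu> \<nu> \<omega>) = secular_prod \<theta> N \<nu> \<mu> \<omega>"
  by (simp add: secular_prod_def mult.commute)

lemma secular_prod_rec:
  "of_nat (\<mu> $ i) * secular_prod \<theta> N \<mu> \<nu> \<omega> =
     of_real (sqrt \<theta>) * (\<Sum>k=1..\<mu> $ i. of_real (sqrt k) * (N k \<omega> * secular_prod \<theta> N (lower \<mu> i k) \<nu> \<omega>))"
proof -
  let ?R = "(\<Prod>j\<in>UNIV-{i}. secular_coeff \<theta> N (\<mu> $ j) \<omega>) * (\<Prod>j\<in>UNIV. cnj (secular_coeff \<theta> N (\<nu> $ j) \<omega>))"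
  \<comment> \<open>Lowering entry \<open>i\<close> leaves all other factors unchanged, so
    \<open>?R\<close> is common to every product in the recursion.\<close>
  have split: "secular_prod \<theta> N \<mu>' \<nu> \<omega> = secular_coeff \<theta> N (\<mu>' $ i) \<omega> * ?R"
    if "\<And>j. j \<noteq> i \<Longrightarrow> \<mu>' $ j = \<mu> $ j" for \<mu>'
  proof -
    have "(\<Prod>j\<in>UNIV-{i}. secular_coeff \<theta> N (\<mu>' $ j) \<omega>) = (\<Prod>j\<in>UNIV-{i}. secular_coeff \<theta> N (\<mu> $ j) \<omega>)"
      using that by (intro prod.cong) auto
    then show ?thesis
      unfolding secular_prod_def prod.distrib
      by (subst prod.remove[of UNIV i]) (auto simp: mult_ac)
  qed
  show ?thesis
    by (simp add: split secular_coeff_rec flip: mult.assoc) (simp add: sum_distrib_left sum_distrib_right mult_ac)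
qed

text \<open>By the Leibniz rule only conjugated factors contribute, and the one at \<open>j\<close>
  is lowered by \<open>k\<close> or, if \<open>\<nu> $ j < k\<close>, killed.\<close>

lemma has_dbar_secular_prod:
  fixes \<mu> \<nu> :: "nat ^ 'k"
  assumes I: "finite I" "k \<in> I" "k \<ge> 1" and \<mu>: "\<And>j. {1..\<mu> $ j} \<subseteq> I" and \<nu>: "\<And>j. {1..\<nu> $ j} \<subseteq> I"
  shows "has_dbar I k N (secular_prod \<theta> N \<mu> \<nu>) (\<lambda>\<omega>. of_real (sqrt (\<theta> / k)) *
           (\<Sum>j | k \<le> \<nu> $ j. secular_prod \<theta> N \<mu> (lower \<nu> j k) \<omega>))"
proof -
  let ?c = "\<lambda>n \<omega>. secular_coeff \<theta> N n \<omega>"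
  let ?D = "\<lambda>n \<omega>. if k \<le> n then of_real (sqrt (\<theta> / k)) * cnj (?c (n - k) \<omega>) else 0"
  have "has_dbar I k N (\<lambda>\<omega>. \<Prod>j\<in>UNIV. ?c (\<mu> $ j) \<omega> * cnj (?c (\<nu> $ j) \<omega>))
     (\<lambda>\<omega>. \<Sum>j\<in>UNIV. (0 * cnj (?c (\<nu> $ j) \<omega>) + ?c (\<mu> $ j) \<omega> * ?D (\<nu> $ j) \<omega>) *
        (\<Prod>j\<in>UNIV - {j}. ?c (\<mu> $ j) \<omega> * cnj (?c (\<nu> $ j) \<omega>)))"
    by (intro has_dbar_prod has_dbar_mult has_dbar_secular_coeff has_dbar_cnj_secular_coeff I \<mu> \<nu>) auto
  moreover have "(0 * cnj (?c (\<nu> $ j) \<omega>) + ?c (\<mu> $ j) \<omega> * ?D (\<nu> $ j) \<omega>) *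
        (\<Prod>j\<in>UNIV - {j}. ?c (\<mu> $ j) \<omega> * cnj (?c (\<nu> $ j) \<omega>)) =
      (if k \<le> \<nu> $ j then of_real (sqrt (\<theta> / k)) * secular_prod \<theta> N \<mu> (lower \<nu> j k) \<omega> else 0)" for j \<omega>
  proof -
    have "secular_prod \<theta> N \<mu> (lower \<nu> j k) \<omega> = ?c (\<mu> $ j) \<omega> * cnj (?c (\<nu> $ j - k) \<omega>) *
        (\<Prod>j\<in>UNIV - {j}. ?c (\<mu> $ j) \<omega> * cnj (?c (\<nu> $ j) \<omega>))"
      unfolding secular_prod_def
      by (subst prod.remove[of UNIV j]) (auto intro!: prod.cong simp: mult.assoc)
    then show ?thesis by simp
  qed
  ultimately show ?thesis
    by (simp add: secular_prod_def[of _ _ \<mu> \<nu>] sum.If_cases sum_distrib_left)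
qed

section \<open>Gaussian integration by parts\<close>

locale complex_gaussian_sequence = prob_space M for M :: "'a measure" +
  fixes N :: "nat \<Rightarrow> 'a \<Rightarrow> complex"
  assumes indep: "indep_vars (\<lambda>_. borel) N {1..}"
    and normal: "k \<ge> 1 \<Longrightarrow> std_complex_normal M (N k)"
begin

lemma monomial_moment:
  assumes "finite I" "I \<subseteq> {1..}"
  shows "has_bochner_integral M (\<lambda>\<omega>. monomial I (\<lambda>i. N i \<omega>) a b)
           (of_real (\<Prod>i\<in>I. half_normal_moment (a i) * half_normal_moment (b i)))"
proof -
  have ind: "indep_vars (\<lambda>_. borel) (\<lambda>i \<omega>. Re (N i \<omega>) ^ a i * Im (N i \<omega>) ^ b i) I"
    by (rule indep_vars_compose2[OF indep_vars_subset[OF indep assms(2)],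
          where Y = "\<lambda>i z. Re z ^ a i * Im z ^ b i"])
       (intro borel_measurable_continuous_onI continuous_intros)
  have mom: "has_bochner_integral M (\<lambda>\<omega>. Re (N i \<omega>) ^ a i * Im (N i \<omega>) ^ b i)
           (half_normal_moment (a i) * half_normal_moment (b i))" if "i \<in> I" for i
    by (rule std_complex_normal_moment, rule normal) (use that assms in auto)
  have "has_bochner_integral M (\<lambda>\<omega>. \<Prod>i\<in>I. Re (N i \<omega>) ^ a i * Im (N i \<omega>) ^ b i)
     (\<Prod>i\<in>I. half_normal_moment (a i) * half_normal_moment (b i))"
    using mom indep_vars_lebesgue_integral[OF assms(1) ind] indep_vars_integrable[OF assms(1) ind]
    by (simp add: has_bochner_integral_iff)
  from has_bochner_integral_of_real[OF this, where 'a = complex] show ?thesis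
    by (simp only: monomial_def of_real_prod)
qed

text \<open>By linearity it suffices to treat monomials, where multiplication by \<open>N k\<close>
  raises an exponent and \<open>half_normal_moment_Suc\<close> lowers it by two. Integrability is
  part of the induction because additivity of the integral needs it.\<close>

lemma integration_by_parts:
  assumes I: "finite I" "I \<subseteq> {1..}" "k \<in> I" and F: "has_dbar I k N F F'"
  shows "integrable M F \<and> integrable M F' \<and> integrable M (\<lambda>\<omega>. N k \<omega> * F \<omega>) \<and>
         (\<integral>\<omega>. N k \<omega> * F \<omega> \<partial>M) = (\<integral>\<omega>. F' \<omega> \<partial>M)"
  using F
proof induction
  case (monomial a b)
  let ?m = "\<lambda>a b. of_real (\<Prod>i\<in>I. half_normal_moment (a i) * half_normal_moment (b i)) :: complex"
  have split: "?m a b = of_real (half_normal_moment (a k)) * of_real (half_normal_moment (b k)) *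
      of_real (\<Prod>i\<in>I-{k}. half_normal_moment (a i) * half_normal_moment (b i))" for a b
    by (subst prod.remove[OF I(1,3)]) simp
  have upd: "(\<Prod>i\<in>I-{k}. half_normal_moment ((a(k := u)) i) * half_normal_moment (b i)) =
      (\<Prod>i\<in>I-{k}. half_normal_moment (a i) * half_normal_moment (b i))"
    "(\<Prod>i\<in>I-{k}. half_normal_moment (a i) * half_normal_moment ((b(k := u)) i)) =
      (\<Prod>i\<in>I-{k}. half_normal_moment (a i) * half_normal_moment (b i))" for u
    by (auto intro!: prod.cong)
  have eq: "N k \<omega> * monomial I (\<lambda>i. N i \<omega>) a b =
      monomial I (\<lambda>i. N i \<omega>) (a(k := Suc (a k))) b + \<i> * monomial I (\<lambda>i. N i \<omega>) a (b(k := Suc (b k)))" for \<omega>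
    unfolding monomial_remove[OF I(1,3)]
    by (subst complex_eq[of "N k \<omega>"]) (simp add: algebra_simps)
  note mm = monomial_moment[OF I(1,2)]
  have 1: "has_bochner_integral M (\<lambda>\<omega>. N k \<omega> * monomial I (\<lambda>i. N i \<omega>) a b)
     (?m (a(k := Suc (a k))) b + \<i> * ?m a (b(k := Suc (b k))))"
    unfolding eq by (intro has_bochner_integral_add has_bochner_integral_mult_right mm)
  have 2: "has_bochner_integral M (\<lambda>\<omega>. dbar_monomial I k (\<lambda>i. N i \<omega>) a b)
     ((of_nat (a k) * ?m (a(k := a k - 1)) b + \<i> * of_nat (b k) * ?m a (b(k := b k - 1))) / 2)"
    unfolding dbar_monomial_def
    by (intro has_bochner_integral_add has_bochner_integral_mult_right has_bochner_integral_divide mm)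
  have "?m (a(k := Suc (a k))) b + \<i> * ?m a (b(k := Suc (b k))) =
     (of_nat (a k) * ?m (a(k := a k - 1)) b + \<i> * of_nat (b k) * ?m a (b(k := b k - 1))) / 2"
    unfolding split upd by (simp add: half_normal_moment_Suc algebra_simps add_divide_distrib)
  with 1 2 mm[of a b] show ?case
    by (simp only: has_bochner_integral_iff simp_thms)
next
  case (add F F' G G')
  then show ?case by (simp add: algebra_simps)
next
  case (scale F F' c)
  then show ?case by (simp add: mult.left_commute[of _ c])
qed


lemma
  fixes \<mu> \<nu> :: "nat ^ 'k"
  assumes "\<theta> \<ge> 0"
  shows integrable_secular_prod: "integrable M (secular_prod \<theta> N \<mu> \<nu>)"
    and expectation_secular_prod_rec:
      "of_nat (\<mu> $ i) * (\<integral>\<omega>. secular_prod \<theta> N \<mu> \<nu> \<omega> \<partial>M) = of_real \<theta> * (\<Sum>k=1..\<mu> $ i.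
         \<Sum>j | k \<le> \<nu> $ j. \<integral>\<omega>. secular_prod \<theta> N (lower \<mu> i k) (lower \<nu> j k) \<omega> \<partial>M)"
proof -
  have int: "integrable M (secular_prod \<theta> N \<mu> \<nu>)" (is ?int)
    and ibp: "k \<ge> 1 \<Longrightarrow> integrable M (\<lambda>\<omega>. N k \<omega> * secular_prod \<theta> N \<mu> \<nu> \<omega>) \<and>
      (\<integral>\<omega>. N k \<omega> * secular_prod \<theta> N \<mu> \<nu> \<omega> \<partial>M) =
      of_real (sqrt (\<theta> / k)) * (\<integral>\<omega>. (\<Sum>j | k \<le> \<nu> $ j. secular_prod \<theta> N \<mu> (lower \<nu> j k) \<omega>) \<partial>M)" (is "_ \<Longrightarrow> ?ibp")
    for \<mu> \<nu> :: "nat ^ 'k" and k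
  proof -
    \<comment> \<open>All variables occurring in the product must lie in \<open>I\<close>, as must
      \<open>k\<close>; the extra \<open>1\<close> guarantees \<open>1 \<in> I\<close>, even at
      \<open>k = 0\<close> with zero margins.\<close>
    define I where "I = {1..k + 1 + (\<Sum>j\<in>UNIV. \<mu> $ j + \<nu> $ j)}"
    have le: "\<mu> $ j + \<nu> $ j \<le> (\<Sum>j\<in>UNIV. \<mu> $ j + \<nu> $ j)" for j
      by (rule member_le_sum) auto
    have sub: "{1..\<mu> $ j} \<subseteq> I" "{1..\<nu> $ j} \<subseteq> I" for j
      using le[of j] by (auto simp: I_def)
    have I: "finite I" "I \<subseteq> {1..}" and k: "k \<ge> 1 \<Longrightarrow> k \<in> I" and 1: "1 \<in> I"
      by (auto simp: I_def)
    \<comment> \<open>Integrability does not involve \<open>k\<close>, so differentiation at index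
      \<open>1\<close> serves.\<close>
    show ?int
      using integration_by_parts[OF I 1 has_dbar_secular_prod[OF I(1) 1 _ sub]] by simp
    show ?ibp if "k \<ge> 1"
      using integration_by_parts[OF I k[OF that] has_dbar_secular_prod[OF I(1) k[OF that] that sub, where \<theta> = \<theta> and N = N]]
      by simp
  qed
  show "integrable M (secular_prod \<theta> N \<mu> \<nu>)" by (rule int)
  have "of_nat (\<mu> $ i) * (\<integral>\<omega>. secular_prod \<theta> N \<mu> \<nu> \<omega> \<partial>M) =
      (\<integral>\<omega>. of_real (sqrt \<theta>) * (\<Sum>k=1..\<mu> $ i. of_real (sqrt k) * (N k \<omega> * secular_prod \<theta> N (lower \<mu> i k) \<nu> \<omega>)) \<partial>M)"
    unfolding secular_prod_rec[symmetric] by simp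
  also have "\<dots> = of_real (sqrt \<theta>) * (\<Sum>k=1..\<mu> $ i. of_real (sqrt k) *
      (\<integral>\<omega>. N k \<omega> * secular_prod \<theta> N (lower \<mu> i k) \<nu> \<omega> \<partial>M))"
    using ibp by (subst Bochner_Integration.integral_mult_right) (auto simp: Bochner_Integration.integral_sum)
  also have "\<dots> = of_real (sqrt \<theta>) * (\<Sum>k=1..\<mu> $ i. of_real (sqrt \<theta>) *
      (\<Sum>j | k \<le> \<nu> $ j. \<integral>\<omega>. secular_prod \<theta> N (lower \<mu> i k) (lower \<nu> j k) \<omega> \<partial>M))"
  proof (rule arg_cong2[where f = "(*)"], rule refl, rule sum.cong, rule refl)
    fix k assume "k \<in> {1..\<mu> $ i}"
    then have k: "k \<ge> 1" by simp
    \<comment> \<open>The weight \<open>sqrt k\<close> of the recursion cancels the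
      \<open>1 / sqrt k\<close> of the derivative, leaving a second factor
      \<open>sqrt \<theta>\<close>.\<close>
    then have "sqrt k * sqrt (\<theta> / k) = sqrt \<theta>"
      by (simp add: real_sqrt_divide)
    then have "complex_of_real (sqrt k) * of_real (sqrt (\<theta> / k)) = of_real (sqrt \<theta>)"
      by (metis of_real_mult)
    then show "of_real (sqrt k) * (\<integral>\<omega>. N k \<omega> * secular_prod \<theta> N (lower \<mu> i k) \<nu> \<omega> \<partial>M) = of_real (sqrt \<theta>) *
      (\<Sum>j | k \<le> \<nu> $ j. \<integral>\<omega>. secular_prod \<theta> N (lower \<mu> i k) (lower \<nu> j k) \<omega> \<partial>M)"
      using ibp[OF k, of "lower \<mu> i k" \<nu>] int by (simp add: Bochner_Integration.integral_sum flip: mult.assoc)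
  qed
  finally show "of_nat (\<mu> $ i) * (\<integral>\<omega>. secular_prod \<theta> N \<mu> \<nu> \<omega> \<partial>M) = of_real \<theta> * (\<Sum>k=1..\<mu> $ i.
         \<Sum>j | k \<le> \<nu> $ j. \<integral>\<omega>. secular_prod \<theta> N (lower \<mu> i k) (lower \<nu> j k) \<omega> \<partial>M)"
    using assms by (simp add: sum_distrib_left flip: of_real_mult mult.assoc)
qed

end

section \<open>The recursion for magic squares\<close>

text \<open>With \<open>g a\<close> for the binomial weight, absorption gives
  \<open>(a + 1) * g (a + 1) = a * g a + \<theta> * g a\<close>; the last term is the new summand
  \<open>k = 1\<close>.\<close>

lemma weighted_gbinomial_sum:
  fixes \<theta> :: real
  shows "real a * ((real a + \<theta> - 1) gchoose a) = \<theta> * (\<Sum>k=1..a. (real (a - k) + \<theta> - 1) gchoose (a - k))"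
proof (induction a)
  case (Suc a)
  have 1: "real (Suc a) * ((real (Suc a) + \<theta> - 1) gchoose Suc a) = (real a + \<theta>) * ((real a + \<theta> - 1) gchoose a)"
    using Suc_times_gbinomial[of a "real a + \<theta> - 1"] by (simp add: algebra_simps)
  have 2: "(\<Sum>k=1..Suc a. h (Suc a - k)) = h a + (\<Sum>k=1..a. h (a - k))" for h :: "nat \<Rightarrow> real"
    by (subst sum.atLeast_Suc_atMost) (simp_all add: sum.shift_bounds_cl_Suc_ivl del: sum.cl_ivl_Suc)
  show ?case
    unfolding 1 2[of "\<lambda>k. (real k + \<theta> - 1) gchoose k"] distrib_left distrib_right Suc by simp
qed simp

definition magic_sum :: "(nat \<Rightarrow> real) \<Rightarrow> nat ^ 'k \<Rightarrow> nat ^ 'k \<Rightarrow> real" where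
  "magic_sum g \<mu> \<nu> = (\<Sum>A\<in>Mag \<mu> \<nu>. \<Prod>i\<in>UNIV. \<Prod>j\<in>UNIV. g (A $ i $ j))"

lemma Mag_le:
  assumes "A \<in> Mag \<mu> \<nu>"
  shows "A $ i $ j \<le> \<mu> $ i" "A $ i $ j \<le> \<nu> $ j"
  using assms member_le_sum[of j UNIV "\<lambda>j. A $ i $ j"] member_le_sum[of i UNIV "\<lambda>i. A $ i $ j"]
  by (auto simp: Mag_def)

definition map_entry :: "(nat \<Rightarrow> nat) \<Rightarrow> 'k \<Rightarrow> 'k \<Rightarrow> nat ^ 'k ^ 'k \<Rightarrow> nat ^ 'k ^ 'k" where
  "map_entry f i j A = (\<chi> i' j'. if i' = i \<and> j' = j then f (A $ i $ j) else A $ i' $ j')"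

lemma map_entry_nth [simp]:
  "map_entry f i j A $ i' $ j' = (if i' = i \<and> j' = j then f (A $ i $ j) else A $ i' $ j')"
  by (simp add: map_entry_def)

lemma sum_row_map_entry:
  "(\<Sum>j'\<in>UNIV. map_entry f i j A $ i' $ j') =
     (if i' = i then f (A $ i $ j) + (\<Sum>j'\<in>UNIV-{j}. A $ i $ j') else (\<Sum>j'\<in>UNIV. A $ i' $ j'))"
  by (auto simp: sum.remove[of UNIV j] intro!: sum.cong)

lemma sum_column_map_entry:
  "(\<Sum>i'\<in>UNIV. map_entry f i j A $ i' $ j') =
     (if j' = j then f (A $ i $ j) + (\<Sum>i'\<in>UNIV-{i}. A $ i' $ j) else (\<Sum>i'\<in>UNIV. A $ i' $ j'))"
  by (auto simp: sum.remove[of UNIV i] intro!: sum.cong)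

lemma Mag_row_column:
  assumes "A \<in> Mag \<mu> \<nu>"
  shows "A $ i $ j + (\<Sum>j'\<in>UNIV-{j}. A $ i $ j') = \<mu> $ i"
    and "A $ i $ j + (\<Sum>i'\<in>UNIV-{i}. A $ i' $ j) = \<nu> $ j"
  using assms sum.remove[of UNIV j "\<lambda>j. A $ i $ j"] sum.remove[of UNIV i "\<lambda>i. A $ i $ j"]
  by (simp_all add: Mag_def)

text \<open>With \<open>raise_entry_in_Mag\<close> this gives the bijection between squares whose
  entry at \<open>(i, j)\<close> is at least \<open>k\<close> and squares with both margins lowered
  by \<open>k\<close>.\<close>

lemma lower_entry_in_Mag:
  assumes "A \<in> Mag \<mu> \<nu>" "k \<le> A $ i $ j"
  shows "map_entry (\<lambda>a. a - k) i j A \<in> Mag (lower \<mu> i k) (lower \<nu> j k)"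
  using assms Mag_row_column[OF assms(1), of i j]
  by (auto simp: Mag_def sum_row_map_entry sum_column_map_entry simp del: map_entry_nth)

lemma raise_entry_in_Mag:
  assumes "A \<in> Mag (lower \<mu> i k) (lower \<nu> j k)" "k \<le> \<mu> $ i" "k \<le> \<nu> $ j"
  shows "map_entry (\<lambda>a. a + k) i j A \<in> Mag \<mu> \<nu>"
  using assms Mag_row_column[OF assms(1), of i j]
  by (auto simp: Mag_def sum_row_map_entry sum_column_map_entry simp del: map_entry_nth)

text \<open>Writing \<open>\<mu> $ i\<close> as the sum of row \<open>i\<close> distributes the
  factor over the entries of that row, and the identity for \<open>g\<close> then applies to one
  entry at a time.\<close>

lemma magic_sum_rec:
  fixes \<mu> \<nu> :: "nat ^ 'k"
  assumes g: "\<And>a. real a * g a = \<theta> * (\<Sum>k=1..a. g (a - k))"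
  shows "real (\<mu> $ i) * magic_sum g \<mu> \<nu> =
           \<theta> * (\<Sum>k=1..\<mu> $ i. \<Sum>j | k \<le> \<nu> $ j. magic_sum g (lower \<mu> i k) (lower \<nu> j k))"
proof -
  define W where "W A = (\<Prod>i\<in>UNIV. \<Prod>j\<in>UNIV. g (A $ i $ j))" for A :: "nat ^ 'k ^ 'k"
  define L where "L j k = map_entry (\<lambda>a. a - k) i j" for j :: 'k and k
  have W_eq: "W B = g (B $ i $ j) * (\<Prod>(i', j')\<in>UNIV - {(i, j)}. g (B $ i' $ j'))" for B j
    unfolding W_def by (simp add: prod.cartesian_product prod.remove[of UNIV "(i, j)"])
  have entry: "real (A $ i $ j) * W A = \<theta> * (\<Sum>k=1..A $ i $ j. W (L j k A))" for A j
  proof -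
    have "W (L j k A) = g (A $ i $ j - k) * (\<Prod>(i', j')\<in>UNIV - {(i, j)}. g (A $ i' $ j'))" for k
    proof -
      have "(\<Prod>(i', j')\<in>UNIV - {(i, j)}. g (L j k A $ i' $ j')) = (\<Prod>(i', j')\<in>UNIV - {(i, j)}. g (A $ i' $ j'))"
        by (rule prod.cong) (auto simp: L_def split: if_splits)
      then show ?thesis
        unfolding W_eq[of _ j] by (simp add: L_def)
    qed
    then show ?thesis
      unfolding W_eq[of A j] by (simp add: g sum_distrib_right flip: mult.assoc)
  qed
  have "real (\<mu> $ i) * magic_sum g \<mu> \<nu> = (\<Sum>A\<in>Mag \<mu> \<nu>. (\<Sum>j\<in>UNIV. real (A $ i $ j)) * W A)"
    by (auto simp: magic_sum_def W_def Mag_def sum_distrib_left simp flip: of_nat_sum intro!: sum.cong)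
  also have "\<dots> = (\<Sum>A\<in>Mag \<mu> \<nu>. \<Sum>j\<in>UNIV. \<theta> * (\<Sum>k=1..A $ i $ j. W (L j k A)))"
    by (simp add: sum_distrib_right entry)
  \<comment> \<open>The range of \<open>k\<close> is made independent of \<open>A\<close> and
    \<open>j\<close>, so that the sums can be interchanged.\<close>
  also have "\<dots> = (\<Sum>A\<in>Mag \<mu> \<nu>. \<Sum>j\<in>UNIV. \<Sum>k=1..\<mu> $ i. if k \<le> A $ i $ j then \<theta> * W (L j k A) else 0)"
  proof (intro sum.cong refl)
    fix A j assume "A \<in> Mag \<mu> \<nu>"
    from Mag_le(1)[OF this, of i j]
    have "{k \<in> {1..\<mu> $ i}. k \<le> A $ i $ j} = {1..A $ i $ j}" by auto
    then show "\<theta> * (\<Sum>k=1..A $ i $ j. W (L j k A)) =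
        (\<Sum>k=1..\<mu> $ i. if k \<le> A $ i $ j then \<theta> * W (L j k A) else 0)"
      by (simp add: sum_distrib_left flip: sum.inter_filter)
  qed
  also have "\<dots> = (\<Sum>k=1..\<mu> $ i. \<Sum>j\<in>UNIV. \<Sum>A\<in>Mag \<mu> \<nu>. if k \<le> A $ i $ j then \<theta> * W (L j k A) else 0)"
    by (subst sum.swap, subst (2) sum.swap, subst sum.swap) (rule refl)
  also have "\<dots> = (\<Sum>k=1..\<mu> $ i. \<Sum>j\<in>UNIV. if k \<le> \<nu> $ j then \<theta> * magic_sum g (lower \<mu> i k) (lower \<nu> j k) else 0)"
  proof (intro sum.cong refl)
    fix k and j :: 'k assume k: "k \<in> {1..\<mu> $ i}"
    have "(\<Sum>A\<in>Mag \<mu> \<nu>. if k \<le> A $ i $ j then \<theta> * W (L j k A) else 0) =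
        (\<Sum>A\<in>{A \<in> Mag \<mu> \<nu>. k \<le> A $ i $ j}. \<theta> * W (L j k A))"
      by (simp add: finite_Mag sum.inter_filter)
    also have "\<dots> = (if k \<le> \<nu> $ j then \<theta> * magic_sum g (lower \<mu> i k) (lower \<nu> j k) else 0)"
    proof (cases "k \<le> \<nu> $ j")
      case True
      \<comment> \<open>Lowering and raising the entry by \<open>k\<close> are mutually inverse
        here, since \<open>k\<close> is at most both \<open>\<mu> $ i\<close> and
        \<open>\<nu> $ j\<close>.\<close>
      have "(\<Sum>A\<in>{A \<in> Mag \<mu> \<nu>. k \<le> A $ i $ j}. \<theta> * W (L j k A)) =
          (\<Sum>A\<in>Mag (lower \<mu> i k) (lower \<nu> j k). \<theta> * W A)"
        by (rule sum.reindex_bij_witness[of _ "map_entry (\<lambda>a. a + k) i j" "L j k"])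
           (use k True in \<open>auto simp: L_def vec_eq_iff intro: lower_entry_in_Mag raise_entry_in_Mag\<close>)
      with True show ?thesis by (simp add: magic_sum_def W_def sum_distrib_left)
    next
      case False
      then have empty: "{A \<in> Mag \<mu> \<nu>. k \<le> A $ i $ j} = {}"
        using Mag_le(2)[of _ \<mu> \<nu> i j] order_trans by blast
      with False show ?thesis by (simp only: empty sum.empty if_False)
    qed
    finally show "(\<Sum>A\<in>Mag \<mu> \<nu>. if k \<le> A $ i $ j then \<theta> * W (L j k A) else 0) =
        (if k \<le> \<nu> $ j then \<theta> * magic_sum g (lower \<mu> i k) (lower \<nu> j k) else 0)" .
  qed
  also have "\<dots> = \<theta> * (\<Sum>k=1..\<mu> $ i. \<Sum>j | k \<le> \<nu> $ j. magic_sum g (lower \<mu> i k) (lower \<nu> j k))"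
    by (simp add: sum.If_cases sum_distrib_left)
  finally show ?thesis .
qed

lemma Mag_0: "Mag 0 (\<nu> :: nat ^ 'k) = (if \<nu> = 0 then {0} else {})"
proof -
  have "A = 0" if "A \<in> Mag 0 \<nu>" for A
    using Mag_le(1)[OF that] by (simp add: vec_eq_iff)
  moreover have "0 \<in> Mag 0 \<nu> \<longleftrightarrow> \<nu> = 0"
    by (auto simp: Mag_def vec_eq_iff)
  ultimately show ?thesis by auto
qed

section \<open>Comparison of the two recursions\<close>

lemma (in complex_gaussian_sequence) expectation_secular_prod:
  fixes \<mu> \<nu> :: "nat ^ 'k"
  assumes "\<theta> > 0"
  shows "(\<integral>\<omega>. secular_prod \<theta> N \<mu> \<nu> \<omega> \<partial>M) =
           of_real (magic_sum (\<lambda>a. (real a + \<theta> - 1) gchoose a) \<mu> \<nu>)"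
proof (induction "\<Sum>i\<in>UNIV. \<mu> $ i" arbitrary: \<mu> \<nu> rule: less_induct)
  case less
  let ?g = "\<lambda>a. (real a + \<theta> - 1) gchoose a"
  have rec: "of_nat (\<mu> $ i) * (\<integral>\<omega>. secular_prod \<theta> N \<mu> \<nu> \<omega> \<partial>M) = of_real \<theta> * (\<Sum>k=1..\<mu> $ i.
         \<Sum>j | k \<le> \<nu> $ j. \<integral>\<omega>. secular_prod \<theta> N (lower \<mu> i k) (lower \<nu> j k) \<omega> \<partial>M)" for i and \<mu> \<nu> :: "nat ^ 'k"
    by (rule expectation_secular_prod_rec) (use assms in simp)
  show ?case
  proof (cases "\<mu> = 0")
    case False
    then obtain i where i: "\<mu> $ i > 0" by (auto simp: vec_eq_iff)
    \<comment> \<open>The total of \<open>\<mu>\<close> drops strictly because \<open>k\<close>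
      starts at \<open>1\<close>, so the induction hypothesis covers every term of the
      recursion.\<close>
    have "(\<Sum>j\<in>UNIV. lower \<mu> i k $ j) < (\<Sum>j\<in>UNIV. \<mu> $ j)" if "k \<in> {1..\<mu> $ i}" for k
      by (rule sum_strict_mono_ex1) (use i that in \<open>auto intro!: bexI[of _ i]\<close>)
    then have "of_nat (\<mu> $ i) * (\<integral>\<omega>. secular_prod \<theta> N \<mu> \<nu> \<omega> \<partial>M) =
        of_real (\<theta> * (\<Sum>k=1..\<mu> $ i. \<Sum>j | k \<le> \<nu> $ j. magic_sum ?g (lower \<mu> i k) (lower \<nu> j k)))"
      by (simp add: rec less)
    also have "\<dots> = of_nat (\<mu> $ i) * of_real (magic_sum ?g \<mu> \<nu>)"
      by (subst magic_sum_rec[OF weighted_gbinomial_sum, symmetric]) simp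
    finally show ?thesis using i by simp
  next
    case [simp]: True
    show ?thesis
    proof (cases "\<nu> = 0")
      case True
      then show ?thesis
        by (simp add: secular_prod_def magic_sum_def Mag_0 prob_space)
    next
      case False
      then obtain i where i: "\<nu> $ i > 0" by (auto simp: vec_eq_iff)
      \<comment> \<open>With the margins exchanged, no column of the zero vector admits
        \<open>k \<ge> 1\<close>, so the recursion has no terms.\<close>
      have "of_nat (\<nu> $ i) * (\<integral>\<omega>. secular_prod \<theta> N \<nu> 0 \<omega> \<partial>M) = 0"
        unfolding rec by (auto intro!: sum.neutral)
      with i have "(\<integral>\<omega>. secular_prod \<theta> N \<nu> 0 \<omega> \<partial>M) = 0" by simp
      then have "(\<integral>\<omega>. secular_prod \<theta> N 0 \<nu> \<omega> \<partial>M) = 0"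
        by (subst cnj_secular_prod[symmetric]) simp
      with False show ?thesis by (simp add: magic_sum_def Mag_0)
    qed
  qed
qed

theorem theorem1p6:
  fixes M :: "'a measure"
    and N :: "nat \<Rightarrow> 'a \<Rightarrow> complex"
    and \<theta> :: real
    and \<mu> \<nu> :: "nat ^ 'k"
  assumes "prob_space M"
    and "prob_space.indep_vars M (\<lambda>_. borel) N {1..}"
    and "\<And>k. k \<ge> 1 \<Longrightarrow> std_complex_normal M (N k)"
    and "\<theta> > 0"
  shows "integrable M (\<lambda>\<omega>. \<Prod>j\<in>UNIV. secular_coeff \<theta> N (\<mu> $ j) \<omega> * cnj (secular_coeff \<theta> N (\<nu> $ j) \<omega>)) \<and>
    (\<integral>\<omega>. (\<Prod>j\<in>UNIV. secular_coeff \<theta> N (\<mu> $ j) \<omega> * cnj (secular_coeff \<theta> N (\<nu> $ j) \<omega>)) \<partial>M) =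
      of_real (\<Sum>A\<in>Mag \<mu> \<nu>. \<Prod>i\<in>UNIV. \<Prod>j\<in>UNIV.
        (real (A $ i $ j) + \<theta> - 1) gchoose (A $ i $ j))"
proof -
  interpret complex_gaussian_sequence M N
    by (intro complex_gaussian_sequence.intro complex_gaussian_sequence_axioms.intro assms)
  show ?thesis
    using integrable_secular_prod[of \<theta> \<mu> \<nu>] \<open>\<theta> > 0\<close> expectation_secular_prod[OF \<open>\<theta> > 0\<close>, of \<mu> \<nu>]
    by (simp add: secular_prod_def magic_sum_def)
qed

end
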